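(* Let $\xi^t$ be a Markov chain on a locally compact metric space $(X,\varrho)$ with transition probabilities $P^t(x,A)$, and fix a coupling $(\xi^t,\acute\xi^t)$ of two copies of this chain, given by laws $\mathbb{P}_{x,y}$, $x,y\in X$. Assume that there exists an invariant probability measure $\mu$ for the Markov chain $\xi^t$ and that $$\mathbb{P}_{x,y}(\tau^\varepsilon<\infty)=1\qquad\forall x,y\in X,\ \forall\varepsilon>0 .$$ Then $\mu$ is the only invariant probability measure of this Markov chain, and $P^t_*\nu\to\mu$ weakly as $t\to\infty$ for any probability measure $\nu$ on $X$.
   Context: $(X,\mathcal{B})$ is a measurable space equipped with a metric $\varrho$ such that $(X,\varrho)$ is a locally compact metric space ($\mathcal B$ is its Borel sigma-algebra). A Markov chain $\xi^t$ (time $t\ge 0$) on $X$ is defined by transition probabilities $P^t(x,A)$, $x\in X$, $A\in\mathcal{B}$, and an initial distribution. It generates the semigroups $P^t\phi(x):=\int\phi(y)\,P^t(x,dy)$ on bounded measurable functions and $P^t_*\mu(\phi):=\mu(P^t\phi)$ on measures, where $\mu(\phi):=\int\phi\,d\mu$. A measure $\mu$ is invariant if $P^t_*\mu=\mu$ for all $t$. A coupling is a pairs process $(\xi^t,\acute\xi^t)$ on $X\times X$ whose law $\mathbb{P}_{x,y}$ depends measurably on the initial points $\xi^0=x$, $\acute\xi^0=y$, such that each component is a version of the same Markov chain: $\mathbb{P}_{x,y}((\xi^t,\acute\xi^t)\in A\times X)=P^t(x,A)$ and $\mathbb{P}_{x,y}((\xi^t,\acute\xi^t)\in X\times A)=P^t(y,A)$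 for all $t\ge0$, $A\in\mathcal{B}$. The coupling is not assumed to be Markovian. For $\varepsilon>0$ the quasi intersection time $\tau^\varepsilon$ is the first moment of time such that $\varrho(\xi^t,\acute\xi^t)\le\varepsilon$ for all $t\ge\tau^\varepsilon$ ($\tau^\varepsilon=\infty$ if there is no such moment). *)

theory Defs
  imports "HOL-Probability.Probability"
begin

text \<open>Time is either discrete or continuous; both are embedded in the reals.\<close>

definition time_set :: "real set \<Rightarrow> bool" where
  "time_set T \<longleftrightarrow> T = \<nat> \<or> T = {0..}"

definition at_infinity_in :: "real set \<Rightarrow> real filter" where
  "at_infinity_in T = inf at_top (principal T)"

definition transition_function ::
    "real set \<Rightarrow> (real \<Rightarrow> 'a::metric_space \<Rightarrow> 'a measure) \<Rightarrow> bool" where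
  "transition_function T P \<longleftrightarrow>
     (\<forall>t\<in>T. P t \<in> borel \<rightarrow>\<^sub>M prob_algebra borel) \<and>
     (\<forall>x. P 0 x = return borel x) \<and>
     (\<forall>s\<in>T. \<forall>t\<in>T. \<forall>x. P (s + t) x = bind (P s x) (P t))"

definition trans_op :: "(real \<Rightarrow> 'a::metric_space \<Rightarrow> 'a measure) \<Rightarrow> real \<Rightarrow> ('a \<Rightarrow> real) \<Rightarrow> 'a \<Rightarrow> real" where
  "trans_op P t \<phi> x = (\<integral>y. \<phi> y \<partial>P t x)"

text \<open>The measure with \<open>A \<mapsto> \<integral> P\<^sup>t(x, A) \<mu>(dx)\<close>; the lemma below is the duality with the
  operators \<open>trans_op\<close> that characterises it.\<close>

definition push_meas :: "(real \<Rightarrow> 'a::metric_space \<Rightarrow> 'a measure) \<Rightarrow> real \<Rightarrow> 'a measure \<Rightarrow> 'a measure" where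
  "push_meas P t \<mu> = bind \<mu> (P t)"

lemma integral_push_meas:
  fixes P :: "real \<Rightarrow> 'a::metric_space \<Rightarrow> 'a measure"
  assumes P: "transition_function T P" "t \<in> T"
    and \<mu>: "prob_space \<mu>" "sets \<mu> = sets borel"
    and \<phi>: "\<phi> \<in> borel_measurable borel" "bounded (range \<phi>)"
  shows "(\<integral>x. \<phi> x \<partial>push_meas P t \<mu>) = (\<integral>x. trans_op P t \<phi> x \<partial>\<mu>)"
proof -
  interpret prob_space \<mu> by fact
  obtain B where B: "\<And>x. \<bar>\<phi> x\<bar> \<le> B"
    using \<phi>(2) by (auto simp: bounded_iff)
  have K: "P t \<in> \<mu> \<rightarrow>\<^sub>M prob_algebra borel"
    using P \<mu>(2) by (auto simp: transition_function_def cong: measurable_cong_sets)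
  have pr: "prob_space (P t x)" for x
    using measurable_space[OF K, of x] sets_eq_imp_space_eq[OF \<mu>(2)]
    by (simp add: space_prob_algebra)
  show ?thesis
    unfolding push_meas_def trans_op_def
    by (rule integral_bind[where B = B and B' = 1 and K = borel])
       (use measurable_prob_algebraD[OF K] \<phi>(1) B pr in
          \<open>auto simp: prob_space.emeasure_space_1 finite_measure_axioms not_empty\<close>)
qed

definition invariant_prob ::
    "real set \<Rightarrow> (real \<Rightarrow> 'a::metric_space \<Rightarrow> 'a measure) \<Rightarrow> 'a measure \<Rightarrow> bool" where
  "invariant_prob T P \<mu> \<longleftrightarrow>
     prob_space \<mu> \<and> sets \<mu> = sets borel \<and> (\<forall>t\<in>T. push_meas P t \<mu> = \<mu>)"

definition weakly_tendsto ::
    "('i \<Rightarrow> 'a::metric_space measure) \<Rightarrow> 'a measure \<Rightarrow> 'i filter \<Rightarrow> bool" where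
  "weakly_tendsto N \<mu> F \<longleftrightarrow>
     (\<forall>f :: 'a \<Rightarrow> real. continuous_on UNIV f \<and> bounded (range f) \<longrightarrow>
        ((\<lambda>t. \<integral>x. f x \<partial>N t) \<longlongrightarrow> (\<integral>x. f x \<partial>\<mu>)) F)"

text \<open>The pairs process \<open>Z\<close> lives on an arbitrary measurable space \<open>\<Omega>\<close> (for instance a path
  space with \<open>Z\<close> the coordinate process); \<open>PP x y\<close> is the law started from \<open>(x, y)\<close>. No
  Markov property is required of \<open>Z\<close>.\<close>

definition coupling ::
    "real set \<Rightarrow> (real \<Rightarrow> 'a::metric_space \<Rightarrow> 'a measure) \<Rightarrow> 'w measure \<Rightarrow>
     ('a \<Rightarrow> 'a \<Rightarrow> 'w measure) \<Rightarrow> (real \<Rightarrow> 'w \<Rightarrow> 'a \<times> 'a) \<Rightarrow> bool" where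
  "coupling T P \<Omega> PP Z \<longleftrightarrow>
     (\<lambda>(x, y). PP x y) \<in> borel \<Otimes>\<^sub>M borel \<rightarrow>\<^sub>M prob_algebra \<Omega> \<and>
     (\<forall>t\<in>T. Z t \<in> \<Omega> \<rightarrow>\<^sub>M borel \<Otimes>\<^sub>M borel) \<and>
     (\<forall>x y. AE \<omega> in PP x y. Z 0 \<omega> = (x, y)) \<and>
     (\<forall>x y. \<forall>t\<in>T. \<forall>A\<in>sets borel.
        \<P>(\<omega> in PP x y. Z t \<omega> \<in> A \<times> UNIV) = measure (P t x) A \<and>
        \<P>(\<omega> in PP x y. Z t \<omega> \<in> UNIV \<times> A) = measure (P t y) A)"

text \<open>The infimum of the empty set is \<open>\<infinity>\<close>. In continuous time the infimum need not be attained;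
  this does not affect whether it is finite.\<close>

definition quasi_intersection_time ::
    "real set \<Rightarrow> (real \<Rightarrow> 'w \<Rightarrow> 'a::metric_space \<times> 'a) \<Rightarrow> real \<Rightarrow> 'w \<Rightarrow> ereal" where
  "quasi_intersection_time T Z \<epsilon> \<omega> =
     Inf {ereal s | s. s \<in> T \<and> (\<forall>t\<in>T. s \<le> t \<longrightarrow> dist (fst (Z t \<omega>)) (snd (Z t \<omega>)) \<le> \<epsilon>)}"

end

theory Submission
  imports Defs
begin

text \<open>
  Let \<open>f\<close> be bounded and uniformly continuous. Once the two copies stay \<open>\<epsilon>\<close>-close forever, the
  values of \<open>f\<close> along them stay close as well, so finiteness of every quasi intersection time
  implies that \<open>f(\<xi>\<^sup>t) - f(\<xi>'\<^sup>t)\<close> tends to \<open>0\<close> almost surely, whatever the starting points \<open>x\<close> and \<open>y\<close>.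
  Taking expectations uses only the one-time marginals of the coupling and gives
  \<open>P\<^sup>t f(x) - P\<^sup>t f(y) \<longrightarrow> 0\<close> (\<open>trans_op_diff_tendsto_0\<close>). Averaging
  over \<open>y\<close> with respect to \<open>\<mu>\<close> turns \<open>P\<^sup>t f(y)\<close> into the constant \<open>\<mu>(f)\<close>, by invariance; averaging
  over \<open>x\<close> with respect to \<open>\<nu>\<close> turns \<open>P\<^sup>t f(x)\<close> into the integral of \<open>f\<close> against the law at time \<open>t\<close>
  of the chain started from \<open>\<nu>\<close> (\<open>push_meas_tendsto_invariant\<close>).

  For an arbitrary bounded continuous \<open>f\<close>, closeness of the copies does not make the values of
  \<open>f\<close> close. Such an \<open>f\<close> is however a pointwise limit of bounded Lipschitz functions from below,
  and so is \<open>-f\<close>; this squeezes the integrals of \<open>f\<close> (\<open>weakly_tendsto_lipschitzI\<close>). The same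
  approximation, applied to indicators of open sets, shows that the integrals of Lipschitz
  functions determine a probability measure (\<open>measure_eqI_lipschitz\<close>). Uniqueness follows: if
  \<open>\<nu>\<close> is invariant, its integrals do not depend on time, so they equal their limits.

  The space may be non-separable. Then the distance need not be measurable for the product of the
  Borel sigma-algebras, and events such as ``the copies are \<open>\<epsilon>\<close>-close'' have to be avoided.
  Differences of values of \<open>f\<close> are always measurable, and closeness of the copies enters only
  through almost sure statements.
\<close>

section \<open>Lipschitz functions determine weak limits\<close>

lemma integrable_bounded_borel:
  fixes f :: "'a::metric_space \<Rightarrow> real"
  assumes "prob_space M" "sets M = sets borel" "f \<in> borel_measurable borel" "\<And>x. \<bar>f x\<bar> \<le> B"
  shows "integrable M f"
proof -
  interpret prob_space M by fact
  have "f \<in> borel_measurable M"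
    using assms(2,3) by (simp cong: measurable_cong_sets)
  then show ?thesis
    by (rule integrable_const_bound[rotated]) (use assms(4) in auto)
qed

text \<open>
  Lower semicontinuity, rather than continuity, is assumed so that indicators of open sets are
  covered. The approximants are the inf-convolutions \<open>g\<^sub>n(x) = inf\<^sub>y (f(y) + n \<cdot> dist x y)\<close>: each is
  an infimum of \<open>n\<close>-Lipschitz functions, and as \<open>n\<close> grows only points \<open>y\<close> near \<open>x\<close> can compete with
  \<open>y = x\<close> for the infimum, where \<open>f\<close> is not much smaller than \<open>f(x)\<close>.
\<close>

lemma lipschitz_approx_from_below:
  fixes f :: "'a::metric_space \<Rightarrow> real"
  assumes bound: "\<And>x. \<bar>f x\<bar> \<le> B"
    and lsc: "\<And>x e. e > 0 \<Longrightarrow> eventually (\<lambda>y. f x - e < f y) (nhds x)"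
  obtains g :: "nat \<Rightarrow> 'a \<Rightarrow> real" where
    "\<And>n. (real n)-lipschitz_on UNIV (g n)"
    "\<And>n x. \<bar>g n x\<bar> \<le> B"
    "\<And>n x. g n x \<le> f x"
    "\<And>x. (\<lambda>n. g n x) \<longlonglongrightarrow> f x"
proof -
  define g where "g n x = (INF y. f y + real n * dist x y)" for n x
  have low: "- B \<le> f y + real n * dist x y" for n x y
  proof -
    have "- B \<le> f y" using bound[of y] by auto
    moreover have "0 \<le> real n * dist x y" by simp
    ultimately show ?thesis by linarith
  qed
  have bdd: "bdd_below (range (\<lambda>y. f y + real n * dist x y))" for n x
    using low by (intro bdd_belowI[of _ "- B"]) auto
  have g_le: "g n x \<le> f y + real n * dist x y" for n x y
    unfolding g_def by (rule cINF_lower[OF bdd]) simp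
  have le_g: "c \<le> g n x" if "\<And>y. c \<le> f y + real n * dist x y" for c n x
    unfolding g_def by (rule cINF_greatest) (use that in auto)
  have below: "g n x \<le> f x" for n x
    using g_le[of n x x] by simp
  have step: "g n x - g n y \<le> real n * dist x y" for n x y
  proof -
    have "g n x - real n * dist x y \<le> g n y"
    proof (rule le_g)
      fix z
      have "real n * dist x z \<le> real n * (dist x y + dist y z)"
        by (intro mult_left_mono dist_triangle) simp
      then show "g n x - real n * dist x y \<le> f z + real n * dist y z"
        using g_le[of n x z] by (simp add: algebra_simps)
    qed
    then show ?thesis by linarith
  qed
  show thesis
  proof
    fix n x
    show "(real n)-lipschitz_on UNIV (g n)"
    proof (rule lipschitz_onI)
      fix x y
      show "dist (g n x) (g n y) \<le> real n * dist x y"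
        using step[of n x y] step[of n y x] by (simp add: dist_real_def dist_commute)
    qed simp
    show "\<bar>g n x\<bar> \<le> B"
      using le_g[OF low, of n x] below[of n x] bound[of x] by auto
    show "g n x \<le> f x" by (rule below)
  next
    fix x
    show "(\<lambda>n. g n x) \<longlonglongrightarrow> f x"
    proof (rule order_tendstoI)
      fix a assume "f x < a"
      then show "eventually (\<lambda>n. g n x < a) sequentially"
        using below le_less_trans by (blast intro: always_eventually)
    next
      fix a assume a: "a < f x"
      define e where "e = (f x - a) / 2"
      have e: "e > 0" "a < f x - e" using a by (auto simp: e_def field_simps)
      obtain d where d: "d > 0" "\<And>y. dist y x < d \<Longrightarrow> f x - e < f y"
        using lsc[OF e(1), of x] by (auto simp: eventually_nhds_metric)
      obtain N where N: "2 * B / d < real N" using reals_Archimedean2 by blast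
      have "a < g n x" if n: "n \<ge> N" for n
      proof -
        have "f x - e \<le> g n x"
        proof (rule le_g)
          fix y
          show "f x - e \<le> f y + real n * dist x y"
          proof (cases "dist x y < d")
            case True
            then have "f x - e < f y" using d(2) by (simp add: dist_commute)
            moreover have "0 \<le> real n * dist x y" by simp
            ultimately show ?thesis by linarith
          next
            \<comment> \<open>Far from \<open>x\<close> the penalty exceeds the oscillation \<open>2 * B\<close> of \<open>f\<close>.\<close>
            case False
            have "2 * B \<le> real N * d" using N d(1) by (simp add: field_simps)
            also have "\<dots> \<le> real n * dist x y"
              using False n d(1) by (intro mult_mono) auto
            finally show ?thesis using bound[of x] bound[of y] e(1) by linarith
          qed
        qed
        then show ?thesis using e(2) by linarith
      qed
      then show "eventually (\<lambda>n. a < g n x) sequentially"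
        by (auto simp: eventually_sequentially)
    qed
  qed
qed

lemma integral_lipschitz_approx:
  fixes f :: "'a::metric_space \<Rightarrow> real"
  assumes M: "prob_space M" "sets M = sets borel"
    and g: "\<And>n. (real n)-lipschitz_on UNIV (g n)" "\<And>n x. \<bar>g n x\<bar> \<le> B"
      "\<And>x. (\<lambda>n. g n x) \<longlonglongrightarrow> f x"
  shows "(\<lambda>n. \<integral>x. g n x \<partial>M) \<longlonglongrightarrow> (\<integral>x. f x \<partial>M)"
proof -
  interpret prob_space M by fact
  have gm: "g n \<in> borel_measurable borel" for n
    using lipschitz_on_continuous_on[OF g(1)] by (rule borel_measurable_continuous_onI)
  have fm: "f \<in> borel_measurable borel"
    by (rule borel_measurable_LIMSEQ_real[OF g(3) gm])
  show ?thesis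
    by (rule integral_dominated_convergence[where w = "\<lambda>_. B"])
       (use gm fm g M(2) in \<open>auto cong: measurable_cong_sets\<close>)
qed

text \<open>
  The indicator of an open set is lower semicontinuous, so its integral is a limit of integrals of
  Lipschitz functions, and open sets are an intersection-stable generator.
\<close>

lemma measure_eqI_lipschitz:
  fixes M N :: "'a::metric_space measure"
  assumes M: "prob_space M" "sets M = sets borel"
    and N: "prob_space N" "sets N = sets borel"
    and eq: "\<And>f :: 'a \<Rightarrow> real. \<And>L. L-lipschitz_on UNIV f \<Longrightarrow> bounded (range f) \<Longrightarrow>
      (\<integral>x. f x \<partial>M) = (\<integral>x. f x \<partial>N)"
  shows "M = N"
proof -
  interpret M: prob_space M by fact
  interpret N: prob_space N by fact
  have sp: "space M = UNIV" "space N = UNIV"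
    using sets_eq_imp_space_eq[OF M(2)] sets_eq_imp_space_eq[OF N(2)] by auto
  have op: "emeasure M U = emeasure N U" if U: "open U" for U
  proof -
    have lsc: "eventually (\<lambda>y. indicator U x - e < (indicator U y :: real)) (nhds x)"
      if e: "e > 0" for x and e :: real
    proof (cases "x \<in> U")
      case True
      then have "eventually (\<lambda>y. y \<in> U) (nhds x)" by (rule eventually_nhds_in_open[OF U])
      then show ?thesis by eventually_elim (use e in \<open>auto simp: indicator_def\<close>)
    qed (use e in \<open>auto simp: indicator_def intro!: always_eventually\<close>)
    have ind: "\<bar>indicator U x :: real\<bar> \<le> 1" for x by (auto simp: indicator_def)
    obtain g :: "nat \<Rightarrow> 'a \<Rightarrow> real" where g: "\<And>n. (real n)-lipschitz_on UNIV (g n)" "\<And>n x. \<bar>g n x\<bar> \<le> 1"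
      "\<And>n x. g n x \<le> indicator U x" "\<And>x. (\<lambda>n. g n x) \<longlonglongrightarrow> indicator U x"
      by (rule lipschitz_approx_from_below[of "indicator U :: 'a \<Rightarrow> real" 1, OF ind], rule lsc, assumption, rule that)
    have "(\<integral>x. g n x \<partial>M) = (\<integral>x. g n x \<partial>N)" for n
      by (rule eq[OF g(1)]) (use g(2) in \<open>auto simp: bounded_iff\<close>)
    then have "(\<lambda>n. \<integral>x. g n x \<partial>M) \<longlonglongrightarrow> (\<integral>x. indicator U x \<partial>N)"
      using integral_lipschitz_approx[OF N g(1,2,4)] by simp
    then have "(\<integral>x. indicator U x \<partial>M) = (\<integral>x. (indicator U x :: real) \<partial>N)"
      using integral_lipschitz_approx[OF M g(1,2,4)] LIMSEQ_unique by blast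
    then show ?thesis
      using sp by (simp add: M.emeasure_eq_measure N.emeasure_eq_measure)
  qed
  show ?thesis
  proof (rule measure_eqI_generator_eq[where E = "Collect open" and \<Omega> = UNIV and A = "\<lambda>_. UNIV"])
    show "Int_stable (Collect open :: 'a set set)" by (auto simp: Int_stable_def)
  qed (use op M(2) N(2) M.emeasure_space_1 sp in \<open>simp_all add: sets_borel\<close>)
qed

text \<open>
  If \<open>g \<le> f\<close> is Lipschitz with \<open>\<integral> g \<partial>M\<close> close to \<open>\<integral> f \<partial>M\<close>, then the integrals of \<open>f\<close> against \<open>N i\<close>
  are eventually at least about \<open>\<integral> g \<partial>M\<close>. This one-sided bound is used for \<open>f\<close> and for \<open>-f\<close>.
  The measures \<open>N i\<close> are constrained only eventually because \<open>P\<^sup>t\<close> is arbitrary for \<open>t\<close> outside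
  the time set.
\<close>

lemma weakly_tendsto_lipschitzI:
  fixes N :: "'i \<Rightarrow> 'a::metric_space measure"
  assumes M: "prob_space M" "sets M = sets borel"
    and N: "eventually (\<lambda>i. prob_space (N i) \<and> sets (N i) = sets borel) F"
    and conv: "\<And>f :: 'a \<Rightarrow> real. \<And>L. L-lipschitz_on UNIV f \<Longrightarrow> bounded (range f) \<Longrightarrow>
      ((\<lambda>i. \<integral>x. f x \<partial>N i) \<longlongrightarrow> (\<integral>x. f x \<partial>M)) F"
  shows "weakly_tendsto N M F"
proof -
  have lower: "eventually (\<lambda>i. a < (\<integral>x. f x \<partial>N i)) F"
    if f: "continuous_on UNIV f" and B: "\<And>x. \<bar>f x\<bar> \<le> B" and a: "a < (\<integral>x. f x \<partial>M)"
    for f :: "'a \<Rightarrow> real" and a B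
  proof -
    have lsc: "eventually (\<lambda>y. f x - e < f y) (nhds x)" if "e > 0" for x e
    proof -
      have "(f \<longlongrightarrow> f x) (nhds x)"
        using f by (simp add: continuous_on_eq_continuous_at isCont_def tendsto_at_iff_tendsto_nhds)
      then show ?thesis by (rule order_tendstoD(1)) (use that in simp)
    qed
    obtain g :: "nat \<Rightarrow> 'a \<Rightarrow> real" where g: "\<And>n. (real n)-lipschitz_on UNIV (g n)" "\<And>n x. \<bar>g n x\<bar> \<le> B"
      "\<And>n x. g n x \<le> f x" "\<And>x. (\<lambda>n. g n x) \<longlonglongrightarrow> f x"
      by (rule lipschitz_approx_from_below[of f B, OF B], rule lsc, assumption, rule that)
    obtain n where n: "a < (\<integral>x. g n x \<partial>M)"
      using order_tendstoD(1)[OF integral_lipschitz_approx[OF M g(1,2,4)] a]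
      by (auto simp: eventually_sequentially)
    have "eventually (\<lambda>i. a < (\<integral>x. g n x \<partial>N i)) F"
      by (rule order_tendstoD(1)[OF conv[OF g(1)] n]) (use g(2) in \<open>auto simp: bounded_iff\<close>)
    with N show ?thesis
    proof eventually_elim
      case (elim i)
      have "(\<integral>x. g n x \<partial>N i) \<le> (\<integral>x. f x \<partial>N i)"
      proof (rule integral_mono)
        show "integrable (N i) (g n)"
          using elim g(2) lipschitz_on_continuous_on[OF g(1)]
          by (intro integrable_bounded_borel borel_measurable_continuous_onI) auto
        show "integrable (N i) f"
          using elim f B by (intro integrable_bounded_borel borel_measurable_continuous_onI) auto
      qed (rule g(3))
      with elim show ?case by linarith
    qed
  qed
  show ?thesis
    unfolding weakly_tendsto_def
  proof (intro allI impI)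
    fix f :: "'a \<Rightarrow> real" assume f: "continuous_on UNIV f \<and> bounded (range f)"
    then obtain B where B: "\<And>x. \<bar>f x\<bar> \<le> B" by (auto simp: bounded_iff)
    show "((\<lambda>i. \<integral>x. f x \<partial>N i) \<longlongrightarrow> (\<integral>x. f x \<partial>M)) F"
    proof (rule order_tendstoI)
      fix a assume "a < (\<integral>x. f x \<partial>M)"
      then show "eventually (\<lambda>i. a < (\<integral>x. f x \<partial>N i)) F" using f B by (intro lower[of f B]) auto
    next
      fix a assume "(\<integral>x. f x \<partial>M) < a"
      then have "- a < (\<integral>x. - f x \<partial>M)" by simp
      then have "eventually (\<lambda>i. - a < (\<integral>x. - f x \<partial>N i)) F"
        using f B by (intro lower[of "\<lambda>x. - f x" B]) (auto intro: continuous_on_minus)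
      then show "eventually (\<lambda>i. (\<integral>x. f x \<partial>N i) < a) F" by simp
    qed
  qed
qed

section \<open>Transition probabilities and limits along the time set\<close>

lemma time_set_of_nat: "time_set T \<Longrightarrow> real n \<in> T"
  by (auto simp: time_set_def)

text \<open>
  Reduction of limits in possibly continuous time to sequences of times. The null sets in the
  almost sure statements and the dominated convergence theorem are then used countably often.
\<close>

lemma tendsto_at_infinity_inI:
  fixes h :: "real \<Rightarrow> real"
  assumes "\<And>X. (\<And>n. X n \<in> T) \<Longrightarrow> filterlim X at_top sequentially \<Longrightarrow> (\<lambda>n. h (X n)) \<longlonglongrightarrow> l"
  shows "(h \<longlongrightarrow> l) (at_infinity_in T)"
proof (rule ccontr)
  assume "\<not> (h \<longlongrightarrow> l) (at_infinity_in T)"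
  then obtain e where e: "e > 0" "\<not> eventually (\<lambda>t. dist (h t) l < e) (at_infinity_in T)"
    by (auto simp: tendsto_iff)
  have "\<exists>t\<in>T. real n \<le> t \<and> e \<le> dist (h t) l" for n
  proof (rule ccontr)
    assume "\<not> ?thesis"
    then have "eventually (\<lambda>t. t \<in> T \<longrightarrow> dist (h t) l < e) at_top"
      unfolding eventually_at_top_linorder by (intro exI[of _ "real n"]) (auto simp: not_le)
    with e(2) show False by (simp add: at_infinity_in_def eventually_inf_principal)
  qed
  then obtain X where X: "\<And>n. X n \<in> T" "\<And>n. real n \<le> X n" "\<And>n. e \<le> dist (h (X n)) l"
    by metis
  have "filterlim X at_top sequentially"
    by (rule filterlim_at_top_mono[OF filterlim_real_sequentially]) (use X(2) in auto)
  with assms X(1) have "(\<lambda>n. h (X n)) \<longlonglongrightarrow> l" by blast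
  then have "eventually (\<lambda>n. dist (h (X n)) l < e) sequentially"
    using e(1) by (rule tendstoD)
  then obtain n where "dist (h (X n)) l < e" by (auto simp: eventually_sequentially)
  with X(3)[of n] show False by linarith
qed

lemma transition_function_prob:
  assumes "transition_function T P" "t \<in> T"
  shows "prob_space (P t x)" "sets (P t x) = sets borel"
proof -
  have "P t \<in> borel \<rightarrow>\<^sub>M prob_algebra borel" using assms by (auto simp: transition_function_def)
  then have "P t x \<in> space (prob_algebra borel)" by (rule measurable_space) simp
  then show "prob_space (P t x)" "sets (P t x) = sets borel" by (auto simp: space_prob_algebra)
qed

lemma push_meas_prob:
  assumes P: "transition_function T P" "t \<in> T" and \<nu>: "prob_space \<nu>" "sets \<nu> = sets borel"
  shows "prob_space (push_meas P t \<nu>) \<and> sets (push_meas P t \<nu>) = sets borel"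
proof -
  have "P t \<in> borel \<rightarrow>\<^sub>M prob_algebra borel" using P by (auto simp: transition_function_def)
  moreover have "\<nu> \<in> space (prob_algebra borel)" using \<nu> by (simp add: space_prob_algebra)
  ultimately show ?thesis
    unfolding push_meas_def using prob_space_bind' sets_bind' by blast
qed

lemma trans_op_measurable:
  assumes P: "transition_function T P" "t \<in> T"
    and f: "f \<in> borel_measurable borel"
  shows "trans_op P t f \<in> borel_measurable borel"
proof -
  have "P t \<in> borel \<rightarrow>\<^sub>M subprob_algebra borel"
    using P by (auto simp: transition_function_def intro: measurable_prob_algebraD)
  then show ?thesis
    unfolding trans_op_def[abs_def]
    using measurable_compose[OF _ integral_measurable_subprob_algebra[OF f]] by blast
qed

lemma trans_op_bound:
  assumes P: "transition_function T P" "t \<in> T"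
    and f: "f \<in> borel_measurable borel" "\<And>x. \<bar>f x\<bar> \<le> B"
  shows "\<bar>trans_op P t f x\<bar> \<le> B"
proof -
  note pr = transition_function_prob[OF P, of x]
  interpret prob_space "P t x" by (rule pr)
  have int: "integrable (P t x) f" by (rule integrable_bounded_borel[OF pr f])
  have "\<bar>trans_op P t f x\<bar> \<le> (\<integral>y. \<bar>f y\<bar> \<partial>P t x)"
    unfolding trans_op_def by (rule integral_abs_bound)
  also have "\<dots> \<le> B"
    using int f(2) by (intro integral_le_const) auto
  finally show ?thesis .
qed

section \<open>Merging of the two coupled copies\<close>

lemma coupling_prob:
  assumes "coupling T P \<Omega> PP Z"
  shows "prob_space (PP x y)" "sets (PP x y) = sets \<Omega>"
proof -
  have "(\<lambda>(x, y). PP x y) \<in> borel \<Otimes>\<^sub>M borel \<rightarrow>\<^sub>M prob_algebra \<Omega>"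
    using assms by (simp add: coupling_def)
  from measurable_space[OF this, of "(x, y)"]
  have "PP x y \<in> space (prob_algebra \<Omega>)" by (simp add: space_pair_measure)
  then show "prob_space (PP x y)" "sets (PP x y) = sets \<Omega>" by (auto simp: space_prob_algebra)
qed

lemma coupling_measurable:
  assumes "coupling T P \<Omega> PP Z" "t \<in> T"
  shows "(\<lambda>\<omega>. fst (Z t \<omega>)) \<in> PP x y \<rightarrow>\<^sub>M borel" "(\<lambda>\<omega>. snd (Z t \<omega>)) \<in> PP x y \<rightarrow>\<^sub>M borel"
proof -
  have "Z t \<in> \<Omega> \<rightarrow>\<^sub>M borel \<Otimes>\<^sub>M borel" using assms by (simp add: coupling_def)
  then have "Z t \<in> PP x y \<rightarrow>\<^sub>M borel \<Otimes>\<^sub>M borel"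
    using coupling_prob(2)[OF assms(1)] by (simp cong: measurable_cong_sets)
  then show "(\<lambda>\<omega>. fst (Z t \<omega>)) \<in> PP x y \<rightarrow>\<^sub>M borel" "(\<lambda>\<omega>. snd (Z t \<omega>)) \<in> PP x y \<rightarrow>\<^sub>M borel"
    by (auto intro: measurable_compose[OF _ measurable_fst] measurable_compose[OF _ measurable_snd])
qed

text \<open>
  A coupling prescribes the one-time probabilities of sets; comparing set by set turns this
  into equality of laws, so that integrals can be transported.
\<close>

lemma distr_eqI_prob:
  assumes "prob_space M" "X \<in> M \<rightarrow>\<^sub>M K" "prob_space N" "sets N = sets K"
    and "\<And>A. A \<in> sets K \<Longrightarrow> \<P>(\<omega> in M. X \<omega> \<in> A) = measure N A"
  shows "distr M K X = N"
proof -
  interpret M: prob_space M by fact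
  interpret N: prob_space N by fact
  have *: "X -` A \<inter> space M = {\<omega> \<in> space M. X \<omega> \<in> A}" for A by auto
  show ?thesis
    by (rule measure_eqI)
       (use assms in \<open>auto simp: emeasure_distr M.emeasure_eq_measure N.emeasure_eq_measure *\<close>)
qed

lemma coupling_marginals:
  assumes C: "coupling T P \<Omega> PP Z" and P: "transition_function T P" "t \<in> T"
  shows "distr (PP x y) borel (\<lambda>\<omega>. fst (Z t \<omega>)) = P t x"
    and "distr (PP x y) borel (\<lambda>\<omega>. snd (Z t \<omega>)) = P t y"
proof -
  have *: "\<P>(\<omega> in PP x y. Z t \<omega> \<in> A \<times> UNIV) = measure (P t x) A"
    "\<P>(\<omega> in PP x y. Z t \<omega> \<in> UNIV \<times> A) = measure (P t y) A" if "A \<in> sets borel" for A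
    using C P(2) that by (auto simp: coupling_def)
  show "distr (PP x y) borel (\<lambda>\<omega>. fst (Z t \<omega>)) = P t x"
    using *(1) transition_function_prob[OF P] coupling_prob(1)[OF C] coupling_measurable[OF C P(2)]
    by (intro distr_eqI_prob) (simp_all add: mem_Times_iff)
  show "distr (PP x y) borel (\<lambda>\<omega>. snd (Z t \<omega>)) = P t y"
    using *(2) transition_function_prob[OF P] coupling_prob(1)[OF C] coupling_measurable[OF C P(2)]
    by (intro distr_eqI_prob) (simp_all add: mem_Times_iff)
qed

lemma trans_op_diff_coupling:
  assumes C: "coupling T P \<Omega> PP Z" and P: "transition_function T P" "t \<in> T"
    and f: "f \<in> borel_measurable borel" "\<And>x. \<bar>f x\<bar> \<le> B"
  shows "trans_op P t f x - trans_op P t f y =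
    (\<integral>\<omega>. f (fst (Z t \<omega>)) - f (snd (Z t \<omega>)) \<partial>PP x y)"
proof -
  interpret prob_space "PP x y" by (rule coupling_prob[OF C])
  note m = coupling_measurable[OF C P(2), of x y]
  have int: "integrable (PP x y) (\<lambda>\<omega>. f (fst (Z t \<omega>)))" "integrable (PP x y) (\<lambda>\<omega>. f (snd (Z t \<omega>)))"
    using f m by (auto intro!: integrable_const_bound[where B = B] intro: measurable_compose)
  have "trans_op P t f x = (\<integral>\<omega>. f (fst (Z t \<omega>)) \<partial>PP x y)"
    unfolding trans_op_def coupling_marginals(1)[OF C P, of x y, symmetric]
    by (rule integral_distr[OF m(1) f(1)])
  moreover have "trans_op P t f y = (\<integral>\<omega>. f (snd (Z t \<omega>)) \<partial>PP x y)"
    unfolding trans_op_def coupling_marginals(2)[OF C P, of x y, symmetric]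
    by (rule integral_distr[OF m(2) f(1)])
  ultimately show ?thesis using int by simp
qed

text \<open>
  Intersecting the almost sure events for \<open>\<epsilon> = 1/(k+1)\<close> loses only a null set. No event of the
  form \<open>dist \<le> \<epsilon>\<close> is given a probability, so measurability of the distance is not at issue.
\<close>

lemma AE_dist_tendsto_0:
  assumes \<tau>: "\<And>\<epsilon>. \<epsilon> > 0 \<Longrightarrow> AE \<omega> in M. quasi_intersection_time T Z \<epsilon> \<omega> < \<infinity>"
    and X: "\<And>n. X n \<in> T" "filterlim X at_top sequentially"
  shows "AE \<omega> in M. (\<lambda>n. dist (fst (Z (X n) \<omega>)) (snd (Z (X n) \<omega>))) \<longlonglongrightarrow> 0"
proof -
  have "AE \<omega> in M. \<forall>k. quasi_intersection_time T Z (1 / real (Suc k)) \<omega> < \<infinity>"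
    unfolding AE_all_countable by (intro allI \<tau>) simp
  then show ?thesis
  proof eventually_elim
    case (elim \<omega>)
    show ?case
    proof (rule tendstoI)
      fix e :: real assume "e > 0"
      then obtain k where k: "1 / real (Suc k) < e" using nat_approx_posE by blast
      obtain s where s: "\<And>t. t \<in> T \<Longrightarrow> s \<le> t \<Longrightarrow> dist (fst (Z t \<omega>)) (snd (Z t \<omega>)) \<le> 1 / real (Suc k)"
        using elim[rule_format, of k] unfolding quasi_intersection_time_def Inf_less_iff by blast
      have "eventually (\<lambda>n. s \<le> X n) sequentially" using X(2) by (simp add: filterlim_at_top)
      then show "eventually (\<lambda>n. dist (dist (fst (Z (X n) \<omega>)) (snd (Z (X n) \<omega>))) 0 < e) sequentially"
        by eventually_elim (use s X(1) k in \<open>force simp: dist_real_def\<close>)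
    qed
  qed
qed

text \<open>
  Almost sure merging gives convergence in mean by dominated convergence. Plain
  continuity of \<open>f\<close> would not do here: the copies approach each other, but both may leave every
  compact set.
\<close>

lemma trans_op_diff_tendsto_0:
  fixes P :: "real \<Rightarrow> 'a::metric_space \<Rightarrow> 'a measure"
  assumes C: "coupling T P \<Omega> PP Z" and P: "transition_function T P"
    and \<tau>: "\<And>\<epsilon>. \<epsilon> > 0 \<Longrightarrow> AE \<omega> in PP x y. quasi_intersection_time T Z \<epsilon> \<omega> < \<infinity>"
    and f: "uniformly_continuous_on UNIV f" "bounded (range f)"
    and X: "\<And>n. X n \<in> T" "filterlim X at_top sequentially"
  shows "(\<lambda>n. trans_op P (X n) f x - trans_op P (X n) f y) \<longlonglongrightarrow> (0::real)"
proof -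
  interpret prob_space "PP x y" by (rule coupling_prob[OF C])
  obtain B where B: "\<And>x. \<bar>f x\<bar> \<le> B" using f(2) by (auto simp: bounded_iff)
  have fm: "f \<in> borel_measurable borel"
    using f(1) by (intro borel_measurable_continuous_onI uniformly_continuous_imp_continuous)
  let ?D = "\<lambda>n \<omega>. f (fst (Z (X n) \<omega>)) - f (snd (Z (X n) \<omega>))"
  have "(\<lambda>n. \<integral>\<omega>. ?D n \<omega> \<partial>PP x y) \<longlonglongrightarrow> (\<integral>\<omega>. 0 \<partial>PP x y)"
  proof (rule integral_dominated_convergence[where w = "\<lambda>_. 2 * B"])
    show "?D n \<in> borel_measurable (PP x y)" for n
      using coupling_measurable[OF C X(1)] fm by (intro borel_measurable_diff measurable_compose[OF _ fm])
    show "AE \<omega> in PP x y. norm (?D n \<omega>) \<le> 2 * B" for n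
    proof (rule AE_I2)
      fix \<omega>
      show "norm (?D n \<omega>) \<le> 2 * B"
        using B[of "fst (Z (X n) \<omega>)"] B[of "snd (Z (X n) \<omega>)"] by (simp add: abs_le_iff)
    qed
    have "AE \<omega> in PP x y. (\<lambda>n. dist (fst (Z (X n) \<omega>)) (snd (Z (X n) \<omega>))) \<longlonglongrightarrow> 0"
      by (rule AE_dist_tendsto_0[OF \<tau> X])
    then show "AE \<omega> in PP x y. (\<lambda>n. ?D n \<omega>) \<longlonglongrightarrow> 0"
    proof eventually_elim
      case (elim \<omega>)
      have "(\<lambda>n. dist (f (fst (Z (X n) \<omega>))) (f (snd (Z (X n) \<omega>)))) \<longlonglongrightarrow> 0"
        using f(1) elim by (auto simp: uniformly_continuous_on_sequentially)
      then show ?case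
        by (simp add: dist_real_def tendsto_rabs_zero_iff)
    qed
  qed simp_all
  then show ?thesis
    by (simp add: trans_op_diff_coupling[OF C P X(1) fm B, of _ x y])
qed

text \<open>
  The two averages, over \<open>y\<close> under \<open>\<mu>\<close> and over \<open>x\<close> under \<open>\<nu>\<close>, are taken one after the other,
  each by dominated convergence. The first already shows \<open>P\<^sup>t f(x) \<longrightarrow> \<mu>(f)\<close> for every single
  starting point \<open>x\<close>.
\<close>

lemma push_meas_tendsto_invariant:
  fixes P :: "real \<Rightarrow> 'a::metric_space \<Rightarrow> 'a measure"
    and f :: "'a \<Rightarrow> real"
  assumes C: "coupling T P \<Omega> PP Z" and P: "transition_function T P"
    and inv: "invariant_prob T P \<mu>"
    and \<tau>: "\<And>x y \<epsilon>. \<epsilon> > 0 \<Longrightarrow> AE \<omega> in PP x y. quasi_intersection_time T Z \<epsilon> \<omega> < \<infinity>"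
    and f: "uniformly_continuous_on UNIV f" "bounded (range f)"
    and X: "\<And>n. X n \<in> T" "filterlim X at_top sequentially"
    and \<nu>: "prob_space \<nu>" "sets \<nu> = sets borel"
  shows "(\<lambda>n. \<integral>x. f x \<partial>push_meas P (X n) \<nu>) \<longlonglongrightarrow> (\<integral>x. f x \<partial>\<mu>)"
proof -
  obtain B where B: "\<And>x. \<bar>f x\<bar> \<le> B" using f(2) by (auto simp: bounded_iff)
  have fm: "f \<in> borel_measurable borel"
    using f(1) by (intro borel_measurable_continuous_onI uniformly_continuous_imp_continuous)
  have \<mu>: "prob_space \<mu>" "sets \<mu> = sets borel" and inv_t: "\<And>t. t \<in> T \<Longrightarrow> push_meas P t \<mu> = \<mu>"
    using inv by (auto simp: invariant_prob_def)
  interpret \<mu>: prob_space \<mu> by fact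
  interpret \<nu>: prob_space \<nu> by fact
  let ?u = "\<lambda>n. trans_op P (X n) f"
  have um: "?u n \<in> borel_measurable borel" for n by (rule trans_op_measurable[OF P X(1) fm])
  have ub: "\<bar>?u n x\<bar> \<le> B" for n x by (rule trans_op_bound[OF P X(1) fm B])
  have int_u: "(\<integral>y. ?u n y \<partial>\<mu>) = (\<integral>y. f y \<partial>\<mu>)" for n
    using integral_push_meas[OF P X(1) \<mu> fm f(2), of n] inv_t[OF X(1)] by simp
  have pointwise: "(\<lambda>n. ?u n x) \<longlonglongrightarrow> (\<integral>y. f y \<partial>\<mu>)" for x
  proof -
    have "(\<lambda>n. \<integral>y. ?u n x - ?u n y \<partial>\<mu>) \<longlonglongrightarrow> (\<integral>y. 0 \<partial>\<mu>)"
    proof (rule integral_dominated_convergence[where w = "\<lambda>_. 2 * B"])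
      show "(\<lambda>y. ?u n x - ?u n y) \<in> borel_measurable \<mu>" for n
        using um[of n] \<mu>(2) by (auto cong: measurable_cong_sets)
      show "AE y in \<mu>. norm (?u n x - ?u n y) \<le> 2 * B" for n
      proof (rule AE_I2)
        fix y show "norm (?u n x - ?u n y) \<le> 2 * B"
          using ub[of n x] ub[of n y] by (simp add: abs_le_iff)
      qed
      show "AE y in \<mu>. (\<lambda>n. ?u n x - ?u n y) \<longlonglongrightarrow> 0"
        by (intro AE_I2 trans_op_diff_tendsto_0[OF C P \<tau> f X])
    qed simp_all
    moreover have "(\<integral>y. ?u n x - ?u n y \<partial>\<mu>) = ?u n x - (\<integral>y. f y \<partial>\<mu>)" for n
      using integrable_bounded_borel[OF \<mu> um ub, of n] by (simp add: int_u \<mu>.prob_space)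
    ultimately show ?thesis by (simp add: LIM_zero_iff)
  qed
  have "(\<lambda>n. \<integral>x. ?u n x \<partial>\<nu>) \<longlonglongrightarrow> (\<integral>x. (\<integral>y. f y \<partial>\<mu>) \<partial>\<nu>)"
    by (rule integral_dominated_convergence[where w = "\<lambda>_. B"])
       (use um ub pointwise \<nu>(2) in \<open>auto cong: measurable_cong_sets\<close>)
  then show ?thesis
    by (simp add: integral_push_meas[OF P X(1) \<nu> fm f(2)] \<nu>.prob_space)
qed

theorem theorem2p2:
  fixes T :: "real set"
    and P :: "real \<Rightarrow> 'a::metric_space \<Rightarrow> 'a measure"
    and \<Omega> :: "'w measure"
    and PP :: "'a \<Rightarrow> 'a \<Rightarrow> 'w measure"
    and Z :: "real \<Rightarrow> 'w \<Rightarrow> 'a \<times> 'a"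
    and \<mu> :: "'a measure"
  assumes "time_set T"
    and "locally compact (UNIV :: 'a set)"
    and "transition_function T P"
    and "coupling T P \<Omega> PP Z"
    and "invariant_prob T P \<mu>"
    and "\<And>x y \<epsilon>. \<epsilon> > 0 \<Longrightarrow> AE \<omega> in PP x y. quasi_intersection_time T Z \<epsilon> \<omega> < \<infinity>"
  shows "(\<forall>\<mu>'. invariant_prob T P \<mu>' \<longrightarrow> \<mu>' = \<mu>) \<and>
    (\<forall>\<nu>. prob_space \<nu> \<and> sets \<nu> = sets borel \<longrightarrow>
       weakly_tendsto (\<lambda>t. push_meas P t \<nu>) \<mu> (at_infinity_in T))"
proof (intro conjI allI impI)
  note P = assms(3)
  have \<mu>: "prob_space \<mu>" "sets \<mu> = sets borel"
    using assms(5) by (auto simp: invariant_prob_def)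
  note conv = push_meas_tendsto_invariant[OF assms(4) P assms(5,6)
      lipschitz_on_uniformly_continuous]
  {
    fix \<mu>' assume inv': "invariant_prob T P \<mu>'"
    then have \<mu>': "prob_space \<mu>'" "sets \<mu>' = sets borel" "\<And>n. push_meas P (real n) \<mu>' = \<mu>'"
      using time_set_of_nat[OF assms(1)] by (auto simp: invariant_prob_def)
    show "\<mu>' = \<mu>"
    proof (rule measure_eqI_lipschitz[OF \<mu>'(1,2) \<mu>])
      fix f :: "'a \<Rightarrow> real" and L
      assume f: "L-lipschitz_on UNIV f" "bounded (range f)"
      have "(\<lambda>n. \<integral>x. f x \<partial>push_meas P (real n) \<mu>') \<longlonglongrightarrow> (\<integral>x. f x \<partial>\<mu>)"
        by (rule conv[OF _ f time_set_of_nat[OF assms(1)] filterlim_real_sequentially \<mu>'(1,2)])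
      \<comment> \<open>By invariance of \<open>\<mu>'\<close> the sequence is constant.\<close>
      then show "(\<integral>x. f x \<partial>\<mu>') = (\<integral>x. f x \<partial>\<mu>)"
        by (simp add: \<mu>'(3) LIMSEQ_const_iff)
    qed
  next
    fix \<nu> :: "'a measure" assume "prob_space \<nu> \<and> sets \<nu> = sets borel"
    then have \<nu>: "prob_space \<nu>" "sets \<nu> = sets borel" by auto
    show "weakly_tendsto (\<lambda>t. push_meas P t \<nu>) \<mu> (at_infinity_in T)"
    proof (rule weakly_tendsto_lipschitzI[OF \<mu>])
      show "eventually (\<lambda>t. prob_space (push_meas P t \<nu>) \<and> sets (push_meas P t \<nu>) = sets borel)
          (at_infinity_in T)"
        unfolding at_infinity_in_def eventually_inf_principal
        using push_meas_prob[OF P _ \<nu>] by (intro always_eventually) auto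
    next
      fix f :: "'a \<Rightarrow> real" and L
      assume f: "L-lipschitz_on UNIV f" "bounded (range f)"
      show "((\<lambda>t. \<integral>x. f x \<partial>push_meas P t \<nu>) \<longlongrightarrow> (\<integral>x. f x \<partial>\<mu>)) (at_infinity_in T)"
        by (rule tendsto_at_infinity_inI) (rule conv[OF _ f _ _ \<nu>])
    qed
  }
qed

end
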